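(* Let $n\ge 2$ and let $F_n$ be the free group with basis $X=\{x_1,\dots,x_n\}$. Let $W_n$ be the set of all elements $w\in F_n$ whose Whitehead graph (with respect to $X$) has a cut vertex. Then the width of $F_n$ relative to $W_n$ is infinite, i.e. for every natural number $k$ there is an element of $F_n$ that is not a product of at most $k$ elements of $W_n$.
   Context: Width: if $G$ is a group generated by a subset $S$, then for $g\in G$ the length $l_S(g)$ is the minimal $k$ such that $g$ is a product of $k$ elements of $S$; the width $\mathrm{wid}(G,S)$ is the supremum of $l_S(g)$ over $g\in G$ (a natural number or $\infty$). Whitehead graph (simplified version): for an element $w$ of $F_n$, written as a reduced word in letters $X^{\pm1}$, its Whitehead graph $\mathrm{WG}_w$ is the undirected graph whose vertex set is $X^{\pm1}$ (so there are $2n$ vertices) and in which the edges are the pairs $(a,b^{-1})$, where $a,b\in X^{\pm 1}$ are such that the two-letter word $ab$ occurs as a subword (of consecutive letters) of the reduced word $w$. Cut vertex: a vertex $v$ of a graph $\Gamma$ is a cut vertex if removing $v$ along with all its adjacent edges from $\Gamma$ increases the number of connected components of the graph. *)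

theory Defs
  imports
    "HOL-Algebra.Generated_Groups"
    "HOL-Library.Extended_Nat"
    "HOL-Library.Sublist"
    "Graph_Theory.Graph_Theory"
begin

section \<open>Free groups\<close>

text \<open>The pair \<open>(x, True)\<close> is the letter \<open>x\<close>, and \<open>(x, False)\<close> is its formal inverse.\<close>

type_synonym 'a letter = "'a \<times> bool"

definition inv_letter :: "'a letter \<Rightarrow> 'a letter" where
  "inv_letter a = (fst a, \<not> snd a)"

definition letters :: "'a set \<Rightarrow> 'a letter set" where
  "letters X = X \<times> UNIV"

definition reduced :: "'a letter list \<Rightarrow> bool" where
  "reduced w \<longleftrightarrow> successively (\<lambda>a b. b \<noteq> inv_letter a) w"

fun push :: "'a letter \<Rightarrow> 'a letter list \<Rightarrow> 'a letter list" where
  "push a [] = [a]"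
| "push a (b # w) = (if b = inv_letter a then w else a # b # w)"

text \<open>Elements are reduced words. For reduced \<open>v\<close>, \<open>foldr push u v\<close> is the reduced form
  of the concatenation of \<open>u\<close> and \<open>v\<close>.\<close>

definition free_group :: "'a set \<Rightarrow> 'a letter list monoid" where
  "free_group X = \<lparr>carrier = {w. set w \<subseteq> letters X \<and> reduced w},
                   monoid.mult = (\<lambda>u v. foldr push u v), one = []\<rparr>"

lemma inv_letter_inv_letter [simp]: "inv_letter (inv_letter a) = a"
  by (simp add: inv_letter_def)

lemma inv_letter_neq [simp]: "inv_letter a \<noteq> a" "a \<noteq> inv_letter a"
  by (cases a; simp add: inv_letter_def)+

lemma inv_letter_in_letters [simp]: "inv_letter a \<in> letters X \<longleftrightarrow> a \<in> letters X"
  by (cases a) (simp add: inv_letter_def letters_def)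

lemma reduced_Nil [simp]: "reduced []"
  by (simp add: reduced_def)

lemma reduced_tl: "reduced (a # w) \<Longrightarrow> reduced w"
  by (cases w) (simp_all add: reduced_def)

lemma reduced_push: "reduced w \<Longrightarrow> reduced (push a w)"
  by (cases w) (auto simp: reduced_def successively_Cons split: if_splits)

lemma reduced_foldr_push: "reduced w \<Longrightarrow> reduced (foldr push u w)"
  by (induction u) (auto intro: reduced_push)

lemma set_push: "set (push a w) \<subseteq> insert a (set w)"
  by (cases w) auto

lemma set_foldr_push: "set (foldr push u w) \<subseteq> set u \<union> set w"
  by (induction u) (use set_push in fastforce)+

lemma push_push_inv: "reduced w \<Longrightarrow> push a (push (inv_letter a) w) = w"
proof (cases w)
  case (Cons b v)
  then show "reduced w \<Longrightarrow> ?thesis" by (cases v) (auto simp: reduced_def)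
qed simp

lemma push_inv_push: "reduced w \<Longrightarrow> push (inv_letter a) (push a w) = w"
  using push_push_inv[of w "inv_letter a"] by simp

lemma foldr_push_push:
  assumes "reduced w"
  shows "foldr push (push a v) w = push a (foldr push v w)"
  using assms by (cases v) (auto simp: push_push_inv reduced_foldr_push)

lemma foldr_push_assoc:
  assumes "reduced w"
  shows "foldr push (foldr push u v) w = foldr push u (foldr push v w)"
  using assms by (induction u) (simp_all add: foldr_push_push)

lemma reduced_Cons_push: "reduced (a # w) \<Longrightarrow> push a w = a # w"
  by (cases w) (auto simp: reduced_def)

lemma foldr_push_Nil: "reduced w \<Longrightarrow> foldr push w [] = w"
  by (induction w) (auto simp: reduced_tl reduced_Cons_push)

lemma reduced_inverse:
  assumes "reduced w"
  shows "reduced (map inv_letter (rev w))"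
proof -
  have "successively (\<lambda>a b. inv_letter a \<noteq> inv_letter (inv_letter b)) w"
    using assms unfolding reduced_def by (rule successively_mono) auto
  then show ?thesis by (simp add: reduced_def successively_map)
qed

lemma foldr_push_inverse:
  "reduced w \<Longrightarrow> foldr push (map inv_letter (rev w)) w = []"
proof (induction w)
  case (Cons a w)
  then show ?case by (simp add: reduced_tl)
qed simp

lemma group_free_group: "group (free_group X)"
proof (rule groupI)
  fix u v w assume "u \<in> carrier (free_group X)" "v \<in> carrier (free_group X)"
    "w \<in> carrier (free_group X)"
  then show "u \<otimes>\<^bsub>free_group X\<^esub> v \<otimes>\<^bsub>free_group X\<^esub> w
      = u \<otimes>\<^bsub>free_group X\<^esub> (v \<otimes>\<^bsub>free_group X\<^esub> w)"
    by (simp add: free_group_def foldr_push_assoc)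
next
  fix u v assume "u \<in> carrier (free_group X)" "v \<in> carrier (free_group X)"
  then show "u \<otimes>\<^bsub>free_group X\<^esub> v \<in> carrier (free_group X)"
    using set_foldr_push[of u v] by (auto simp: free_group_def reduced_foldr_push)
next
  fix w assume "w \<in> carrier (free_group X)"
  then show "\<exists>v\<in>carrier (free_group X). v \<otimes>\<^bsub>free_group X\<^esub> w = \<one>\<^bsub>free_group X\<^esub>"
    by (intro bexI[of _ "map inv_letter (rev w)"])
      (auto simp: free_group_def foldr_push_inverse reduced_inverse)
qed (auto simp: free_group_def)

definition eval_letter :: "('b, 'c) monoid_scheme \<Rightarrow> ('a \<Rightarrow> 'b) \<Rightarrow> 'a letter \<Rightarrow> 'b" where
  "eval_letter H f a = (if snd a then f (fst a) else inv\<^bsub>H\<^esub> (f (fst a)))"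

definition eval_word :: "('b, 'c) monoid_scheme \<Rightarrow> ('a \<Rightarrow> 'b) \<Rightarrow> 'a letter list \<Rightarrow> 'b" where
  "eval_word H f w = foldr (\<lambda>a g. eval_letter H f a \<otimes>\<^bsub>H\<^esub> g) w \<one>\<^bsub>H\<^esub>"

lemma free_group_generated:
  "generate (free_group X) ((\<lambda>x. [(x, True)]) ` X) = carrier (free_group X)"
proof
  interpret F: group "free_group X" by (rule group_free_group)
  let ?S = "(\<lambda>x. [(x, True)]) ` X"
  have S: "?S \<subseteq> carrier (free_group X)"
    by (auto simp: free_group_def letters_def reduced_def)
  show "generate (free_group X) ?S \<subseteq> carrier (free_group X)"
    using F.generate_in_carrier[OF S] by blast
  show "carrier (free_group X) \<subseteq> generate (free_group X) ?S"
  proof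
    fix w assume "w \<in> carrier (free_group X)"
    then show "w \<in> generate (free_group X) ?S"
    proof (induction w)
      case Nil
      then show ?case using generate.one[of "free_group X" ?S] by (simp add: free_group_def)
    next
      case (Cons a w)
      obtain x s where a: "a = (x, s)" by fastforce
      have x: "x \<in> X" and w: "w \<in> carrier (free_group X)" and r: "reduced (a # w)"
        using Cons.prems a reduced_tl by (auto simp: free_group_def letters_def)
      have inv: "inv\<^bsub>free_group X\<^esub> [(x, True)] = [(x, False)]"
        by (rule F.inv_equality)
          (use x in \<open>auto simp: free_group_def letters_def reduced_def inv_letter_def\<close>)
      have "[a] \<in> generate (free_group X) ?S"
        using generate.incl[of "[(x, True)]" ?S "free_group X"]
          generate.inv[of "[(x, True)]" ?S "free_group X"] x inv a
        by (cases s) auto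
      then have "[a] \<otimes>\<^bsub>free_group X\<^esub> w \<in> generate (free_group X) ?S"
        using Cons.IH[OF w] by (rule generate.eng)
      moreover have "[a] \<otimes>\<^bsub>free_group X\<^esub> w = a # w"
        using r by (simp add: free_group_def reduced_Cons_push)
      ultimately show ?case by simp
    qed
  qed
qed

text \<open>The universal property; uniqueness of the extension follows from
  \<open>free_group_generated\<close>.\<close>

lemma free_group_universal:
  assumes "group H" and f: "f \<in> X \<rightarrow> carrier H"
  shows "eval_word H f \<in> hom (free_group X) H"
    and "x \<in> X \<Longrightarrow> eval_word H f [(x, True)] = f x"
proof -
  interpret H: group H by fact
  have letter: "eval_letter H f a \<in> carrier H" if "a \<in> letters X" for a
    using that f by (auto simp: eval_letter_def letters_def)
  have closed: "eval_word H f w \<in> carrier H" if "set w \<subseteq> letters X" for w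
    using that by (induction w) (auto simp: eval_word_def letter)
  have inv: "eval_letter H f a \<otimes>\<^bsub>H\<^esub> eval_letter H f (inv_letter a) = \<one>\<^bsub>H\<^esub>"
    if "a \<in> letters X" for a
  proof -
    have "f (fst a) \<in> carrier H" using that f by (auto simp: letters_def)
    then show ?thesis by (simp add: eval_letter_def inv_letter_def)
  qed
  have push: "eval_word H f (push a w) = eval_letter H f a \<otimes>\<^bsub>H\<^esub> eval_word H f w"
    if "a \<in> letters X" "set w \<subseteq> letters X" for a w
  proof (cases w)
    case Nil
    then show ?thesis by (simp add: eval_word_def)
  next
    case (Cons b v)
    have v: "eval_word H f v \<in> carrier H" using closed[of v] that Cons by simp
    show ?thesis
    proof (cases "b = inv_letter a")
      case True
      have "eval_letter H f a \<otimes>\<^bsub>H\<^esub> (eval_letter H f b \<otimes>\<^bsub>H\<^esub> eval_word H f v) = eval_word H f v"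
        using H.m_assoc[OF letter[of a] letter[of b] v] inv[of a] that Cons True v by simp
      then show ?thesis using True Cons by (simp add: eval_word_def)
    next
      case False
      then show ?thesis using Cons by (simp add: eval_word_def)
    qed
  qed
  have mult: "eval_word H f (foldr push u v) = eval_word H f u \<otimes>\<^bsub>H\<^esub> eval_word H f v"
    if "set u \<subseteq> letters X" "set v \<subseteq> letters X" for u v
    using that
  proof (induction u)
    case Nil
    then show ?case using closed[of v] by (simp add: eval_word_def)
  next
    case (Cons a u)
    have "set (foldr push u v) \<subseteq> letters X" using set_foldr_push[of u v] Cons.prems by auto
    then have "eval_word H f (foldr push (a # u) v)
        = eval_letter H f a \<otimes>\<^bsub>H\<^esub> (eval_word H f u \<otimes>\<^bsub>H\<^esub> eval_word H f v)"
      using Cons push by simp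
    also have "\<dots> = eval_letter H f a \<otimes>\<^bsub>H\<^esub> eval_word H f u \<otimes>\<^bsub>H\<^esub> eval_word H f v"
      using Cons.prems by (simp add: H.m_assoc letter closed)
    finally show ?case by (simp add: eval_word_def)
  qed
  show "eval_word H f \<in> hom (free_group X) H"
    by (rule homI) (auto simp: free_group_def closed mult)
  show "eval_word H f [(x, True)] = f x" if "x \<in> X"
    using that funcset_mem[OF f that] by (simp add: eval_word_def eval_letter_def)
qed


section \<open>Width\<close>

definition list_prod :: "('a, 'b) monoid_scheme \<Rightarrow> 'a list \<Rightarrow> 'a" where
  "list_prod G gs = foldr (\<lambda>g h. g \<otimes>\<^bsub>G\<^esub> h) gs \<one>\<^bsub>G\<^esub>"

text \<open>An element that is not a product of elements of \<open>S\<close> gets length \<open>\<infinity>\<close>; this does not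
  occur for the set considered here, by \<open>whitehead_cut_set_generates\<close> below.\<close>

definition gen_length :: "('a, 'b) monoid_scheme \<Rightarrow> 'a set \<Rightarrow> 'a \<Rightarrow> enat" where
  "gen_length G S g = (INF gs \<in> {gs. set gs \<subseteq> S \<and> list_prod G gs = g}. enat (length gs))"

definition width :: "('a, 'b) monoid_scheme \<Rightarrow> 'a set \<Rightarrow> enat" where
  "width G S = (SUP g \<in> carrier G. gen_length G S g)"

lemma gen_length_le_iff:
  "gen_length G S g \<le> enat k \<longleftrightarrow> (\<exists>gs. set gs \<subseteq> S \<and> length gs \<le> k \<and> list_prod G gs = g)"
proof
  assume "gen_length G S g \<le> enat k"
  then have "gen_length G S g < enat (Suc k)"
    using le_less_trans[of "gen_length G S g" "enat k" "enat (Suc k)"] by simp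
  then show "\<exists>gs. set gs \<subseteq> S \<and> length gs \<le> k \<and> list_prod G gs = g"
    unfolding gen_length_def Inf_less_iff by auto
next
  assume "\<exists>gs. set gs \<subseteq> S \<and> length gs \<le> k \<and> list_prod G gs = g"
  then show "gen_length G S g \<le> enat k"
    unfolding gen_length_def by (auto intro: INF_lower2)
qed

lemma width_infinite_iff:
  "width G S = \<infinity> \<longleftrightarrow>
    (\<forall>k. \<exists>g\<in>carrier G. \<not> (\<exists>gs. set gs \<subseteq> S \<and> length gs \<le> k \<and> list_prod G gs = g))"
proof -
  have "width G S = \<infinity> \<longleftrightarrow> (\<forall>k. \<not> width G S \<le> enat k)"
    by (cases "width G S") auto
  then show ?thesis
    by (simp add: width_def SUP_le_iff gen_length_le_iff)
qed


section \<open>Whitehead graphs and cut vertices\<close>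

text \<open>Undirected graphs are symmetric digraphs, whose strongly connected components
  \<open>sccs\<close> are the connected components.\<close>

definition whitehead_graph :: "'a set \<Rightarrow> 'a letter list \<Rightarrow> 'a letter pair_pre_digraph" where
  "whitehead_graph X w =
    \<lparr>pverts = letters X,
     parcs = {(a, inv_letter b) |a b. sublist [a, b] w} \<union> {(inv_letter b, a) |a b. sublist [a, b] w}\<rparr>"

definition cut_vertex :: "('v, 'e) pre_digraph \<Rightarrow> 'v \<Rightarrow> bool" where
  "cut_vertex G v \<longleftrightarrow> v \<in> verts G \<and>
    card (pre_digraph.sccs G) < card (pre_digraph.sccs (pre_digraph.del_vert G v))"

definition whitehead_cut_set :: "'a set \<Rightarrow> 'a letter list set" where
  "whitehead_cut_set X =
    {w \<in> carrier (free_group X). \<exists>v. cut_vertex (whitehead_graph X w) v}"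

lemma pair_graph_whitehead_graph:
  assumes "finite X" "w \<in> carrier (free_group X)"
  shows "pair_graph (whitehead_graph X w)"
proof -
  have V: "a \<in> letters X" "b \<in> letters X" if "sublist [a, b] w" for a b
    using set_mono_sublist[OF that] assms(2) by (auto simp: free_group_def)
  have ne: "b \<noteq> inv_letter a" if "sublist [a, b] w" for a b
    using that assms(2)
    by (auto simp: free_group_def reduced_def sublist_def successively_append_iff)
  have arcs: "parcs (whitehead_graph X w) \<subseteq> letters X \<times> letters X"
    using V by (auto simp: whitehead_graph_def)
  have fin: "finite (letters X)" using assms(1) by (simp add: letters_def)
  show ?thesis
  proof
    show "finite (pverts (whitehead_graph X w))" using fin by (simp add: whitehead_graph_def)
    show "finite (parcs (whitehead_graph X w))"
      using finite_subset[OF arcs] fin by blast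
    show "symmetric (whitehead_graph X w)"
      unfolding symmetric_def with_proj_simps sym_def whitehead_graph_def by fastforce
  next
    fix e assume e: "e \<in> parcs (whitehead_graph X w)"
    show "fst e \<in> pverts (whitehead_graph X w)" "snd e \<in> pverts (whitehead_graph X w)"
      using subsetD[OF arcs e] by (auto simp: whitehead_graph_def)
    obtain a b where "sublist [a, b] w" "e = (a, inv_letter b) \<or> e = (inv_letter b, a)"
      using e by (auto simp: whitehead_graph_def)
    then show "fst e \<noteq> snd e"
      using ne[of a b] by auto
  qed
qed

lemma cut_vertex_star:
  assumes wf: "wf_digraph (with_proj G)" and fin: "finite (pverts G)"
    and arcs: "parcs G = {(a, p), (p, a), (a, q), (q, a)}"
    and neq: "a \<noteq> p" "a \<noteq> q" "p \<noteq> q"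
  shows "cut_vertex (with_proj G) a"
proof -
  let ?G = "with_proj G" and ?D = "pre_digraph.del_vert (with_proj G) a" and ?T = "{a, p, q}"
  interpret G: wf_digraph ?G by (rule wf)
  interpret D: wf_digraph ?D by (rule G.wf_digraph_del_vert)
  have T: "?T \<subseteq> pverts G"
    using G.tail_in_verts[of "(a, p)"] G.tail_in_verts[of "(p, a)"] G.tail_in_verts[of "(q, a)"]
    by (simp add: arcs)
  have "\<exists>u\<in>pverts G - ?T. S = {u}" if S: "S \<in> pre_digraph.sccs_verts ?G" "S \<noteq> ?T" for S
  proof -
    have refl: "u \<rightarrow>\<^sup>*\<^bsub>?G\<^esub> u" if "u \<in> ?T" for u
      using that T by (intro G.reachable_refl) auto
    have arc: "a \<rightarrow>\<^sup>*\<^bsub>?G\<^esub> p" "p \<rightarrow>\<^sup>*\<^bsub>?G\<^esub> a" "a \<rightarrow>\<^sup>*\<^bsub>?G\<^esub> q" "q \<rightarrow>\<^sup>*\<^bsub>?G\<^esub> a"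
      by (rule G.reachable_adjI; simp add: arcs)+
    have to_a: "u \<rightarrow>\<^sup>*\<^bsub>?G\<^esub> a" and from_a: "a \<rightarrow>\<^sup>*\<^bsub>?G\<^esub> u" if "u \<in> ?T" for u
      using that arc refl[of a] by (metis insertE insertI1 empty_iff)+
    have in_T: "u \<rightarrow>\<^sup>*\<^bsub>?G\<^esub> v" if "u \<in> ?T" "v \<in> ?T" for u v
      using to_a[OF that(1)] from_a[OF that(2)] by (rule G.reachable_trans)
    have step: "u = v \<or> u \<in> ?T \<and> v \<in> ?T" if "u \<rightarrow>\<^sup>*\<^bsub>?G\<^esub> v" for u v
      using that unfolding reachable_def
      by (induction rule: rtrancl_on_induct) (auto simp: arcs)
    obtain u where u: "u \<in> S" using S by (auto simp: G.sccs_verts_def)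
    have uv: "u \<in> pverts G"
      using S u G.reachable_in_verts(1)[of u u] by (auto simp: G.sccs_verts_def)
    have mem: "v \<in> S" if "u \<rightarrow>\<^sup>*\<^bsub>?G\<^esub> v" "v \<rightarrow>\<^sup>*\<^bsub>?G\<^esub> u" for v
      using S(1) u that unfolding G.sccs_verts_def by blast
    have reach: "u \<rightarrow>\<^sup>*\<^bsub>?G\<^esub> v" if "v \<in> S" for v
      using S(1) u that unfolding G.sccs_verts_def by blast
    have "u \<notin> ?T"
    proof
      assume uT: "u \<in> ?T"
      have "S \<subseteq> ?T" using reach step uT by blast
      moreover have "?T \<subseteq> S" using mem in_T uT by blast
      ultimately show False using S(2) by blast
    qed
    moreover have "S = {u}" using u reach step \<open>u \<notin> ?T\<close> by blast
    ultimately show ?thesis using uv by blast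
  qed
  then have "G.sccs_verts \<subseteq> insert ?T ((\<lambda>u. {u}) ` (pverts G - ?T))" by blast
  then have "card G.sccs_verts \<le> card (insert ?T ((\<lambda>u. {u}) ` (pverts G - ?T)))"
    using fin by (intro card_mono) auto
  also have "\<dots> \<le> Suc (card (pverts G - ?T))"
    using fin by (intro order_trans[OF card_insert_le_m1]) (auto simp: card_insert_if card_image)
  also have "\<dots> < card (pverts G - {a})"
  proof -
    have "card ?T \<le> card (pverts G)" using fin T by (rule card_mono)
    then show ?thesis using fin T neq by (simp add: card_Diff_subset)
  qed
  also have "\<dots> = card ((\<lambda>u. {u}) ` (pverts G - {a}))"
    by (simp add: card_image)
  also have "\<dots> \<le> card D.sccs_verts"
  proof (rule card_mono)
    have "D.sccs_verts \<subseteq> Pow (pverts G)"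
      using D.reachable_in_verts(1) unfolding D.sccs_verts_def G.del_vert_simps by fastforce
    then show "finite D.sccs_verts" using fin finite_subset by blast
    have arcs': "arcs_ends ?D = {}"
      using neq arcs by (auto simp: arcs_ends_def G.del_vert_simps)
    have "u = v" if "u \<rightarrow>\<^sup>*\<^bsub>?D\<^esub> v" for u v
      using that unfolding reachable_def arcs' by (induction rule: rtrancl_on_induct) auto
    moreover have "u \<rightarrow>\<^sup>*\<^bsub>?D\<^esub> u" if "u \<in> pverts G - {a}" for u
      using that by (intro D.reachable_refl) (auto simp: G.del_vert_simps)
    ultimately show "(\<lambda>u. {u}) ` (pverts G - {a}) \<subseteq> D.sccs_verts"
      by (auto simp: D.sccs_verts_def G.del_vert_simps)
  qed
  finally have "card G.sccs < card D.sccs"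
    by (simp add: G.card_sccs_verts D.card_sccs_verts)
  then show ?thesis using T by (simp add: cut_vertex_def)
qed

lemma list_prod_append:
  assumes "group G" "set us \<subseteq> carrier G" "set vs \<subseteq> carrier G"
  shows "list_prod G (us @ vs) = list_prod G us \<otimes>\<^bsub>G\<^esub> list_prod G vs"
proof -
  interpret group G by fact
  have closed: "list_prod G ws \<in> carrier G" if "set ws \<subseteq> carrier G" for ws
    using that by (induction ws) (auto simp: list_prod_def)
  show ?thesis
    using assms(2,3) closed[OF assms(3)]
  proof (induction us)
    case (Cons g us)
    then show ?case
      using closed[of us] closed[of vs] by (simp add: list_prod_def m_assoc)
  qed (simp add: list_prod_def)
qed

lemma whitehead_cut_set_generates:
  assumes X: "card X \<ge> 2" and g: "g \<in> carrier (free_group X)"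
  shows "\<exists>ws. set ws \<subseteq> whitehead_cut_set X \<and> list_prod (free_group X) ws = g"
proof -
  let ?F = "free_group X" and ?W = "whitehead_cut_set X"
  have fin: "finite X" using X card_ge_0_finite[of X] by linarith
  have W: "?W \<subseteq> carrier ?F" by (auto simp: whitehead_cut_set_def)
  have letter: "\<exists>us. set us \<subseteq> ?W \<and> list_prod ?F us = [a]" if a: "a \<in> letters X" for a
  proof -
    have "\<exists>y\<in>X. y \<noteq> fst a"
    proof (rule ccontr)
      assume "\<not> (\<exists>y\<in>X. y \<noteq> fst a)"
      then have "card X \<le> card {fst a}" by (intro card_mono) auto
      with X show False by simp
    qed
    then obtain y where y: "y \<in> X" "y \<noteq> fst a" by blast
    let ?b = "(y, True)"
    let ?u = "[a, a, a, ?b]" and ?v = "[inv_letter ?b, inv_letter a, inv_letter a]"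
    have b: "?b \<in> letters X" using y by (simp add: letters_def)
    have neq: "?b \<noteq> a" "a \<noteq> ?b" "?b \<noteq> inv_letter a" "inv_letter a \<noteq> ?b" "a \<noteq> inv_letter ?b"
        "inv_letter ?b \<noteq> a" "inv_letter a \<noteq> inv_letter ?b" "inv_letter ?b \<noteq> inv_letter a"
      using y by (auto simp: inv_letter_def)
    have uv: "?u \<in> carrier ?F" "?v \<in> carrier ?F"
      using a b neq by (simp_all add: free_group_def reduced_def)
    let ?E = "{(a, inv_letter a), (inv_letter a, a), (a, inv_letter ?b), (inv_letter ?b, a)}"
    have subu: "sublist [c, d] ?u \<longleftrightarrow> c = a \<and> d = a \<or> c = a \<and> d = ?b" for c d
      by (auto simp: sublist_Cons_right)
    have subv: "sublist [c, d] ?v \<longleftrightarrow> c = inv_letter ?b \<and> d = inv_letter a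
        \<or> c = inv_letter a \<and> d = inv_letter a" for c d
      by (auto simp: sublist_Cons_right)
    have pairs:
      "{(c, inv_letter d) |c d. c = p \<and> d = q \<or> c = r \<and> d = s} = {(p, inv_letter q), (r, inv_letter s)}"
      "{(inv_letter d, c) |c d. c = p \<and> d = q \<or> c = r \<and> d = s} = {(inv_letter q, p), (inv_letter s, r)}"
      for p q r s :: "'a letter" by blast+
    have E: "parcs (whitehead_graph X ?u) = ?E" "parcs (whitehead_graph X ?v) = ?E"
      unfolding whitehead_graph_def subu subv pair_pre_digraph.simps pairs
      by (simp_all add: insert_commute Un_commute)
    have "cut_vertex (whitehead_graph X w) a"
      if "w \<in> carrier ?F" "parcs (whitehead_graph X w) = ?E" for w
    proof -
      interpret pair_graph "whitehead_graph X w"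
        using fin that(1) by (rule pair_graph_whitehead_graph)
      show ?thesis
        using wf_digraph_axioms pair_finite_verts that(2) neq
        by (intro cut_vertex_star[of _ a "inv_letter a" "inv_letter ?b"]) simp_all
    qed
    then have "?u \<in> ?W" "?v \<in> ?W"
      using uv E unfolding whitehead_cut_set_def by blast+
    moreover have "list_prod ?F [?u, ?v] = [a]"
      using neq by (simp add: list_prod_def free_group_def)
    ultimately show ?thesis by (intro exI[of _ "[?u, ?v]"]) simp
  qed
  show ?thesis
    using g
  proof (induction g)
    case Nil
    then show ?case by (intro exI[of _ "[]"]) (simp add: list_prod_def free_group_def)
  next
    case (Cons a g)
    have g: "g \<in> carrier ?F" and a: "a \<in> letters X" and r: "reduced (a # g)"
      using Cons.prems by (auto simp: free_group_def dest: reduced_tl)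
    obtain us where us: "set us \<subseteq> ?W" "list_prod ?F us = [a]" using letter[OF a] by blast
    obtain vs where vs: "set vs \<subseteq> ?W" "list_prod ?F vs = g" using Cons.IH[OF g] by blast
    have "list_prod ?F (us @ vs) = [a] \<otimes>\<^bsub>?F\<^esub> g"
      using us vs W by (subst list_prod_append[OF group_free_group]) auto
    also have "\<dots> = a # g" using r by (simp add: free_group_def reduced_Cons_push)
    finally show ?case using us vs by (intro exI[of _ "us @ vs"]) simp
  qed
qed

end

(* The edges contributed by a positive two-letter word xy join x to the inverse of y. So if a
   positive word u contains all of these words, then the Whitehead graph of every word containing
   u or its inverse contains the complete bipartite graph between X and its inverses, and has no
   cut vertex since |X| is at least 2. Hence the Brooks counting quasimorphism of u (occurrences
   of u minus occurrences of its inverse) vanishes on the given set. Its defect is at most 3|u|,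
   so it is at most 3|u|k in absolute value on products of k elements, whereas on the m-th power
   of u it is at least m, because the negative word inverse to u does not occur in a positive word. *)

theory Submission
  imports Defs
begin

section \<open>Counting occurrences of a subword\<close>

text \<open>Overlapping occurrences all count, as in the big version of Brooks counting.\<close>

fun occ :: "'b list \<Rightarrow> 'b list \<Rightarrow> nat" where
  "occ u [] = 0"
| "occ u (a # w) = of_bool (prefix u (a # w)) + occ u w"

lemma occ_eq_0: "\<not> sublist u w \<Longrightarrow> occ u w = 0"
  by (induction w) (auto simp: sublist_Cons_right)

lemma occ_append_ge: "occ u v + occ u w \<le> occ u (v @ w)"
proof (induction v)
  case (Cons a v)
  have "prefix u (a # v) \<Longrightarrow> prefix u (a # v @ w)"
    by (metis append_Cons prefix_prefix)
  with Cons show ?case by auto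
qed simp

text \<open>Only occurrences that start in \<open>v\<close> and run into \<open>w\<close> are extra.
  In the induction, the new starting position can be one of these only if \<open>u\<close> is longer
  than the rest of \<open>v\<close>, which is exactly when the minimum grows.\<close>

lemma occ_append_le: "occ u (v @ w) \<le> occ u v + occ u w + min (length v) (length u)"
proof (induction v)
  case (Cons a v)
  have "prefix u (a # v)" if "prefix u (a # v @ w)" "length u \<le> Suc (length v)"
    using prefix_length_prefix[of u "(a # v) @ w" "a # v"] that by simp
  with Cons show ?case by (auto simp: min_def split: if_splits)
qed simp

text \<open>Counting by end instead of start, so that reversal can be treated by induction.\<close>

lemma occ_snoc: "u \<noteq> [] \<Longrightarrow> occ u (w @ [a]) = occ u w + of_bool (suffix u (w @ [a]))"
proof (induction w)
  case Nil
  then show ?case by (auto simp: prefix_Cons suffix_Cons)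
next
  case (Cons b w)
  have p: "prefix u (b # w @ [a]) \<longleftrightarrow> prefix u (b # w) \<or> u = b # w @ [a]"
    using prefix_snoc[of u "b # w" a] by auto
  have s: "suffix u (b # w @ [a]) \<longleftrightarrow> suffix u (w @ [a]) \<or> u = b # w @ [a]"
    by (auto simp: suffix_Cons)
  \<comment> \<open>If \<open>u\<close> is the whole word, it starts at the front and ends at the
    back; by length no other test succeeds, so it is counted once on each side.\<close>
  have "\<not> prefix u (b # w)" "\<not> suffix u (w @ [a])" if "u = b # w @ [a]"
    using that prefix_length_le[of u "b # w"] suffix_length_le[of u "w @ [a]"] by auto
  with Cons show ?case using p s by auto
qed

lemma occ_rev: "u \<noteq> [] \<Longrightarrow> occ (rev u) (rev w) = occ u w"
  by (induction w) (auto simp: occ_snoc suffix_to_prefix)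

lemma occ_map: "inj f \<Longrightarrow> occ (map f u) (map f w) = occ u w"
proof (induction w)
  case (Cons a w)
  then have "prefix (map f u) (map f (a # w)) \<longleftrightarrow> prefix u (a # w)"
    by (metis inj_map_eq_map prefix_def map_append prefix_map_rightE)
  with Cons show ?case by simp
qed simp

lemma occ_concat_replicate: "u \<noteq> [] \<Longrightarrow> m \<le> occ u (concat (replicate m u))"
proof (induction m)
  case (Suc m)
  have "1 \<le> occ u u" using Suc.prems by (cases u) auto
  with Suc show ?case using occ_append_ge[of u u "concat (replicate m u)"] by simp
qed simp

section \<open>The Brooks quasimorphism\<close>

definition inv_word :: "'a letter list \<Rightarrow> 'a letter list" where
  "inv_word w = map inv_letter (rev w)"

lemma inv_word_Cons: "inv_word (a # w) = inv_word w @ [inv_letter a]"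
  by (simp add: inv_word_def)

lemma inv_word_inv_word [simp]: "inv_word (inv_word w) = w"
  by (simp add: inv_word_def rev_map comp_def)

lemma inv_word_eq_Nil [simp]: "inv_word w = [] \<longleftrightarrow> w = []"
  by (simp add: inv_word_def)

lemma length_inv_word [simp]: "length (inv_word w) = length w"
  by (simp add: inv_word_def)

lemma inj_inv_letter: "inj inv_letter"
  by (rule injI) (metis inv_letter_inv_letter)

lemma occ_inv_word: "u \<noteq> [] \<Longrightarrow> occ (inv_word u) (inv_word w) = occ u w"
  by (simp add: inv_word_def occ_map inj_inv_letter occ_rev)

definition brooks :: "'a letter list \<Rightarrow> 'a letter list \<Rightarrow> int" where
  "brooks u w = int (occ u w) - int (occ (inv_word u) w)"

text \<open>Each of the two counts has an excess between 0 and \<open>length u\<close>, so the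
  difference of the excesses stays within \<open>length u\<close>.\<close>

lemma brooks_append: "\<bar>brooks u (v @ w) - brooks u v - brooks u w\<bar> \<le> int (length u)"
  using occ_append_ge[of u v w] occ_append_le[of u v w]
    occ_append_ge[of "inv_word u" v w] occ_append_le[of "inv_word u" v w]
  by (simp add: brooks_def)

lemma brooks_inv_word: "u \<noteq> [] \<Longrightarrow> brooks u (inv_word w) = - brooks u w"
  using occ_inv_word[of u w] occ_inv_word[of "inv_word u" w] by (simp add: brooks_def)

text \<open>With \<open>r\<close> the part of \<open>g\<close> that cancels, the product in the free
  group is reduced to plain concatenations, to which \<open>brooks_append\<close> applies.\<close>

lemma foldr_push_cancel:
  assumes "reduced g"
  shows "\<exists>p r q. g = p @ r \<and> h = inv_word r @ q \<and> foldr push g h = p @ q"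
  using assms
proof (induction g)
  case Nil
  then show ?case by (simp add: inv_word_def)
next
  case (Cons a g)
  then obtain p r q where g: "g = p @ r" and h: "h = inv_word r @ q"
    and gh: "foldr push g h = p @ q"
    using reduced_tl by blast
  \<comment> \<open>The new letter can cancel only if \<open>p\<close> is empty: otherwise it meets
    its own neighbour in the reduced word. When it cancels, it joins \<open>r\<close>.\<close>
  consider (cancel) q' where "p = []" "q = inv_letter a # q'" | (push) "push a (p @ q) = a # p @ q"
  proof (cases p)
    case Nil
    have "push a q = a # q" if "\<nexists>q'. q = inv_letter a # q'"
      using that by (cases q) auto
    then show ?thesis using that Nil by auto
  next
    case (Cons b p')
    then have "b \<noteq> inv_letter a" using Cons.prems g by (auto simp: reduced_def)
    then show ?thesis using that(2) Cons by simp
  qed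
  then show ?case
  proof cases
    case cancel
    then show ?thesis using g h gh
      by (intro exI[of _ "[]"] exI[of _ "a # r"] exI[of _ q']) (simp add: inv_word_Cons)
  next
    case push
    then show ?thesis using g h gh
      by (intro exI[of _ "a # p"] exI[of _ r] exI[of _ q]) simp
  qed
qed

text \<open>The three junctions in \<open>p @ r\<close>, \<open>inv_word r @ q\<close> and
  \<open>p @ q\<close> cost \<open>length u\<close> each, while the values at \<open>r\<close> and
  its inverse cancel.\<close>

lemma brooks_mult:
  assumes "u \<noteq> []" "reduced g"
  shows "\<bar>brooks u (foldr push g h) - brooks u g - brooks u h\<bar> \<le> 3 * int (length u)"
proof -
  obtain p r q where eq: "g = p @ r" "h = inv_word r @ q" "foldr push g h = p @ q"
    using foldr_push_cancel[OF assms(2)] by blast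
  show ?thesis
    unfolding eq(3) unfolding eq(1,2)
    using brooks_append[of u p r] brooks_append[of u "inv_word r" q] brooks_append[of u p q]
      brooks_inv_word[OF assms(1), of r] by linarith
qed

lemma brooks_list_prod:
  assumes "u \<noteq> []" "set gs \<subseteq> carrier (free_group X)" "\<And>g. g \<in> set gs \<Longrightarrow> brooks u g = 0"
  shows "\<bar>brooks u (list_prod (free_group X) gs)\<bar> \<le> 3 * int (length u) * int (length gs)"
  using assms(2,3)
proof (induction gs)
  case Nil
  then show ?case by (simp add: list_prod_def free_group_def brooks_def)
next
  case (Cons g gs)
  let ?h = "list_prod (free_group X) gs"
  have "list_prod (free_group X) (g # gs) = foldr push g ?h"
    by (simp add: list_prod_def free_group_def)
  moreover have "reduced g" using Cons.prems(1) by (simp add: free_group_def)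
  moreover have "brooks u g = 0" using Cons.prems(2) by simp
  moreover have "\<bar>brooks u ?h\<bar> \<le> 3 * int (length u) * int (length gs)"
    using Cons by simp
  ultimately show ?case
    using brooks_mult[OF assms(1), of g ?h] by (simp add: algebra_simps)
qed

section \<open>Words without cut vertices\<close>

text \<open>Applied to the graph before and after deleting a vertex: both counts being 1 refutes the
  strict inequality in \<open>cut_vertex\<close>.\<close>

lemma (in wf_digraph) card_sccs_connected:
  assumes "verts G \<noteq> {}" "\<And>a b. a \<in> verts G \<Longrightarrow> b \<in> verts G \<Longrightarrow> a \<rightarrow>\<^sup>*\<^bsub>G\<^esub> b"
  shows "card sccs = 1"
proof -
  have "S = verts G" if S: "S \<in> sccs_verts" for S
  proof
    show "S \<subseteq> verts G"
      using S reachable_in_verts(1) unfolding sccs_verts_def by blast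
    then show "verts G \<subseteq> S"
      using S assms(2) unfolding sccs_verts_def by blast
  qed
  moreover have "verts G \<in> sccs_verts"
    using assms reachable_in_verts(1) unfolding sccs_verts_def by blast
  ultimately have "sccs_verts = {verts G}" by blast
  then show ?thesis by (simp add: card_sccs_verts[symmetric])
qed

lemma no_cut_vertex:
  assumes X: "card X \<ge> 2" and w: "w \<in> carrier (free_group X)"
    and sub: "\<And>x y. x \<in> X \<Longrightarrow> y \<in> X \<Longrightarrow>
      sublist [(x, True), (y, True)] w \<or> sublist [(y, False), (x, False)] w"
  shows "\<not> cut_vertex (whitehead_graph X w) v"
proof
  assume cut: "cut_vertex (whitehead_graph X w) v"
  let ?G = "with_proj (whitehead_graph X w)"
  let ?D = "pre_digraph.del_vert ?G v"
  have fin: "finite X" using X card_ge_0_finite[of X] by linarith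
  interpret G: pair_graph "whitehead_graph X w"
    using fin w by (rule pair_graph_whitehead_graph)
  interpret D: wf_digraph ?D by (rule G.wf_digraph_del_vert)
  have verts: "pverts (whitehead_graph X w) = letters X"
    by (simp add: whitehead_graph_def)
  have edge: "(c, inv_letter d) \<in> parcs (whitehead_graph X w) \<and>
      (inv_letter d, c) \<in> parcs (whitehead_graph X w)" if "sublist [c, d] w" for c d
    unfolding whitehead_graph_def pair_pre_digraph.simps using that by blast
  \<comment> \<open>A two-letter word and its inverse give the same undirected edge, so either
    alternative of \<open>sub\<close> suffices.\<close>
  have "((x, True), (y, False)) \<in> parcs (whitehead_graph X w)"
    "((y, False), (x, True)) \<in> parcs (whitehead_graph X w)" if "x \<in> X" "y \<in> X" for x y
    using sub[OF that] edge[of "(x, True)" "(y, True)"] edge[of "(y, False)" "(x, False)"]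
    by (auto simp: inv_letter_def)
  then have arc: "(a, b) \<in> parcs (whitehead_graph X w)"
    if "a \<in> letters X" "b \<in> letters X" "snd a \<noteq> snd b" for a b
    using that by (cases a; cases b; cases "snd a") (auto simp: letters_def)
  \<comment> \<open>Both sides of the bipartition keep a vertex when \<open>v\<close> is
    removed.\<close>
  have mid: "\<exists>c\<in>letters X. c \<noteq> v \<and> snd c = s" for s
  proof -
    have "\<not> X \<subseteq> {fst v}" using X card_mono[of "{fst v}" X] by auto
    then obtain y where "y \<in> X" "y \<noteq> fst v" by blast
    then show ?thesis by (intro bexI[of _ "(y, s)"]) (auto simp: letters_def)
  qed
  have "a \<rightarrow>\<^sup>*\<^bsub>?G\<^esub> b" if "a \<in> letters X" "b \<in> letters X" for a b
  proof -
    have step: "c \<rightarrow>\<^sup>*\<^bsub>?G\<^esub> d" if "c \<in> letters X" "d \<in> letters X" "snd c \<noteq> snd d" for c d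
      by (rule G.reachable_adjI) (use arc that in simp)
    \<comment> \<open>Two letters of equal sign are joined through a letter of the opposite sign;
      below, the same path avoids \<open>v\<close>.\<close>
    obtain c where "c \<in> letters X" "snd c = (\<not> snd a)" using mid by blast
    then show ?thesis using step[of a b] step[of a c] step[of c b] that G.reachable_trans by metis
  qed
  then have "card G.sccs = 1"
    using mid[of True] verts by (intro G.card_sccs_connected) auto
  moreover have "a \<rightarrow>\<^sup>*\<^bsub>?D\<^esub> b" if "a \<in> letters X - {v}" "b \<in> letters X - {v}" for a b
  proof -
    have step: "c \<rightarrow>\<^sup>*\<^bsub>?D\<^esub> d"
      if "c \<in> letters X - {v}" "d \<in> letters X - {v}" "snd c \<noteq> snd d" for c d
      by (rule D.reachable_adjI)
        (use arc[of c d] that in \<open>force simp: arcs_ends_def arc_to_ends_def G.del_vert_simps\<close>)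
    obtain c where "c \<in> letters X - {v}" "snd c = (\<not> snd a)" using mid by blast
    then show ?thesis using step[of a b] step[of a c] step[of c b] that D.reachable_trans by metis
  qed
  then have "card D.sccs = 1"
    using mid[of True] verts by (intro D.card_sccs_connected) (auto simp: G.del_vert_simps)
  ultimately show False using cut by (simp add: cut_vertex_def)
qed

section \<open>Powers of a positive word and the infinite width\<close>

lemma sublist_inv_word: "sublist u w \<Longrightarrow> sublist (inv_word u) (inv_word w)"
  by (simp add: inv_word_def map_mono_sublist)

lemma reduced_positive: "set w \<subseteq> UNIV \<times> {True} \<Longrightarrow> reduced w"
  by (induction w rule: induct_list012) (auto simp: reduced_def inv_letter_def)

theorem mainTheorem3:
  fixes X :: "'a set" and n :: nat
  assumes "n \<ge> 2" and "finite X" and "card X = n"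
  shows "width (free_group X) (whitehead_cut_set X) = \<infinity>"
  unfolding width_infinite_iff
proof
  fix k
  have X: "card X \<ge> 2" using assms by simp
  obtain xs where xs: "set xs = X" using finite_list[OF assms(2)] by blast
  \<comment> \<open>All pairs are listed, including \<open>x = y\<close>. Further two-letter words
    arise where the pieces meet; they only add edges.\<close>
  define u where "u = concat (map (\<lambda>(x, y). [(x, True), (y, True)]) (List.product xs xs))"
  have set_u: "set u \<subseteq> X \<times> {True}" by (auto simp: u_def xs)
  have u_sub: "sublist [(x, True), (y, True)] u" if xy: "x \<in> X" "y \<in> X" for x y
  proof -
    have "(x, y) \<in> set (List.product xs xs)" using xy xs by simp
    then obtain as bs where "List.product xs xs = as @ (x, y) # bs" by (meson split_list)
    then show ?thesis by (simp add: u_def sublist_def) (metis append_Cons append_Nil)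
  qed
  have "X \<noteq> {}" using X by auto
  then have u: "u \<noteq> []" using u_sub by fastforce
  have zero: "brooks u w = 0" if w: "w \<in> whitehead_cut_set X" for w
  proof -
    have "\<not> sublist u w \<and> \<not> sublist (inv_word u) w"
    proof (rule ccontr)
      assume "\<not> ?thesis"
      then have "sublist [(x, True), (y, True)] w \<or> sublist [(y, False), (x, False)] w"
        if "x \<in> X" "y \<in> X" for x y
        using u_sub[OF that] sublist_inv_word[OF u_sub[OF that]] sublist_order.order_trans
        by (auto simp: inv_word_def inv_letter_def)
      then show False using no_cut_vertex[OF X] w by (auto simp: whitehead_cut_set_def)
    qed
    then show ?thesis by (simp add: brooks_def occ_eq_0)
  qed
  \<comment> \<open>One more than the bound for products of at most \<open>k\<close> elements of the
    cut set.\<close>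
  define m where "m = Suc (3 * length u * k)"
  define g where "g = concat (replicate m u)"
  have set_g: "set g \<subseteq> X \<times> {True}" using set_u by (auto simp: g_def)
  then have "g \<in> carrier (free_group X)"
    by (auto simp: free_group_def letters_def intro!: reduced_positive)
  moreover have "\<not> (\<exists>gs. set gs \<subseteq> whitehead_cut_set X \<and> length gs \<le> k \<and>
      list_prod (free_group X) gs = g)"
  proof
    assume "\<exists>gs. set gs \<subseteq> whitehead_cut_set X \<and> length gs \<le> k \<and> list_prod (free_group X) gs = g"
    then obtain gs where gs: "set gs \<subseteq> whitehead_cut_set X" "length gs \<le> k"
      "list_prod (free_group X) gs = g" by blast
    have "\<bar>brooks u g\<bar> \<le> 3 * int (length u) * int (length gs)"
      using brooks_list_prod[OF u, of gs X] gs zero by (auto simp: whitehead_cut_set_def)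
    also have "\<dots> \<le> 3 * int (length u) * int k"
      using gs(2) by (intro mult_left_mono) auto
    finally have "brooks u g < int m" by (simp add: m_def)
    \<comment> \<open>Hence nothing is subtracted in \<open>brooks u g\<close>, and the
      \<open>m\<close> copies of \<open>u\<close> contradict the bound.\<close>
    moreover have "\<not> sublist (inv_word u) g"
    proof
      assume "sublist (inv_word u) g"
      then have "set (inv_word u) \<subseteq> X \<times> {True}" using set_mono_sublist set_g by blast
      then show False using set_u u by (cases u) (auto simp: inv_word_def inv_letter_def)
    qed
    ultimately show False
      using occ_concat_replicate[OF u, of m] by (simp add: brooks_def occ_eq_0 g_def)
  qed
  ultimately show "\<exists>g\<in>carrier (free_group X). \<not> (\<exists>gs. set gs \<subseteq> whitehead_cut_set X \<and>
      length gs \<le> k \<and> list_prod (free_group X) gs = g)" by blast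
qed

end
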